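(* For each integer $k\ge1$, the set of $\Delta<0$ such that $\mathrm{LC}_k(\Delta)>3$ is discrete.
   Context: For $\Delta<0$ let $F_\Delta:[0,1]\times\mathbb R\to[0,1]\times\mathbb R$ be the piecewise affine map $F_\Delta(\tau,I)=(\bar\tau,\bar I)$ with $\bar\tau=\tau-I\bmod 1$, $\bar I=I+\Delta(\bar\tau-\tfrac12)$. The lines $\{\tau=I\bmod 1\}$ partition $[0,1]\times\mathbb R$ into the fundamental domains $\hat D_n=\{(\tau,I)\in[0,1]\times\mathbb R: n-1<I-\tau<n\}$, $n\in\mathbb Z$ (so $(\frac12,n)\in\hat D_n$), and $F_\Delta$ is continuous on each of them. For $k>0$ put $$\hat D_{n_0,n_1,\dots,n_{k-1}}=\bigcap_{j=0}^{k-1}\mathrm{cl}\bigl(F_\Delta^{-j}\hat D_{n_j}\bigr),$$ where $\mathrm{cl}$ denotes closure and $F_\Delta^{-j}\hat D_{n_j}$ is the preimage of $\hat D_{n_j}$ under $F_\Delta^j$. If $x\in\hat D_{n_0,\dots,n_{k-1}}$, the $k$-tuple of integers $(n_0,\dots,n_{k-1})$ is called a $k$-itinerary of $x$; these sets are not pairwise disjoint, so a point may have several itineraries. For $x\in\mathrm{cl}\,\hat D_0$, $\mathrm{LC}_k(\Delta,x)$ is the number of $k$-itineraries of $x$ with $n_0=0$, and $\mathrm{LC}_k(\Delta)=\max_{x\in\mathrm{cl}\,\hat D_0}\mathrm{LC}_k(\Delta,x)$.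
   Formalization: The set of points with itinerary (n_0,…,n_{k-1}) is taken as the closure of the intersection of the preimages F^{-j}D_{n_j}, not the intersection of their closures; with the latter, LC_3(Δ)>3 for every Δ<0 and the claim fails. *)

theory Defs
  imports "HOL-Analysis.Analysis"
begin

definition strip :: "(real \<times> real) set" where
  "strip = {0..1} \<times> UNIV"

text \<open>
  The residue modulo 1 is taken in \<open>[0,1)\<close>. This choice only affects the values on the lines
  where the map is discontinuous; the sets \<open>itin_domain\<close> below do not depend on it.
\<close>
definition twist_map :: "real \<Rightarrow> real \<times> real \<Rightarrow> real \<times> real" where
  "twist_map \<Delta> = (\<lambda>(\<tau>, I). let \<tau>' = frac (\<tau> - I) in (\<tau>', I + \<Delta> * (\<tau>' - 1/2)))"

definition fund_domain :: "int \<Rightarrow> (real \<times> real) set" where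
  "fund_domain n = {(\<tau>, I). (\<tau>, I) \<in> strip \<and> of_int n - 1 < I - \<tau> \<and> I - \<tau> < of_int n}"

definition preimage_domain :: "real \<Rightarrow> nat \<Rightarrow> int \<Rightarrow> (real \<times> real) set" where
  "preimage_domain \<Delta> j n = {x \<in> strip. (twist_map \<Delta> ^^ j) x \<in> fund_domain n}"

text \<open>
  The set of points with itinerary \<open>(n\<^sub>0, \<dots>, n\<^bsub>k-1\<^esub>)\<close> (meaningful for a nonempty list) is the
  closure of the set of points that run through the open domains \<open>n\<^sub>0, \<dots>, n\<^bsub>k-1\<^esub>\<close>.
  The closure has to be taken of the intersection of the preimages. The intersection of the
  closures of the individual preimages is larger for \<open>k \<ge> 3\<close>: at a point that two cells share it
  also contains the mixed itineraries, whose entries at different times are taken from different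
  cells and which no nearby orbit follows. Counting these would give at least four
  3-itineraries at some point, for every \<open>\<Delta> < 0\<close>.
\<close>
definition itin_domain :: "real \<Rightarrow> int list \<Rightarrow> (real \<times> real) set" where
  "itin_domain \<Delta> ns = closure (\<Inter>j<length ns. preimage_domain \<Delta> j (ns ! j))"

definition itineraries :: "real \<Rightarrow> nat \<Rightarrow> real \<times> real \<Rightarrow> int list set" where
  "itineraries \<Delta> k x = {ns. length ns = k \<and> x \<in> itin_domain \<Delta> ns}"

definition LC_at :: "nat \<Rightarrow> real \<Rightarrow> real \<times> real \<Rightarrow> nat" where
  "LC_at k \<Delta> x = card {ns \<in> itineraries \<Delta> k x. ns ! 0 = 0}"

text \<open>
  Both the counted sets and the set of values are finite (orbits of points of the compact set
  \<open>closure (fund_domain 0)\<close> stay bounded for \<open>k\<close> steps), so \<open>card\<close> and \<open>Max\<close> are not degenerate.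
\<close>
definition LC :: "nat \<Rightarrow> real \<Rightarrow> nat" where
  "LC k \<Delta> = Max (LC_at k \<Delta> ` closure (fund_domain 0))"

end

theory Submission
  imports Defs "HOL-Computational_Algebra.Polynomial"
begin

text \<open>
  On a cell the iterates of the map are affine, and the centred angles \<open>u\<^sub>j = \<tau>\<^sub>j - 1/2\<close> satisfy
  \<open>u\<^bsub>j+1\<^esub> + u\<^bsub>j-1\<^esub> = (2 - \<Delta>) u\<^sub>j + (n\<^sub>j - n\<^bsub>j-1\<^esub>)\<close>. On the closure of a cell they stay in \<open>[-1/2, 1/2]\<close>,
  so if two itineraries of a point split at time \<open>j\<close>, their values of \<open>u\<^bsub>j+1\<^esub>\<close>, which differ by a
  nonzero integer, are \<open>1/2\<close> and \<open>-1/2\<close>. Hence the itineraries form a binary tree, and four of them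
  force either three splits along one itinerary, or one split followed by a further split on each
  side. In both cases solve the recurrence between successive splits as a boundary value problem
  with boundary values \<open>\<plusminus>1/2\<close>, and consider the recurrence at the middle split or, respectively, the
  difference of the two recurrences at the common split. This equates a rational function of
  \<open>\<Delta>\<close> that stays bounded at infinity with a nonconstant affine function of \<open>\<Delta>\<close>, which has finitely
  many solutions. For bounded \<open>\<Delta>\<close> only finitely many itineraries, hence equations, occur.
\<close>

section \<open>Boundary value problems for a forced recurrence\<close>

text \<open>
  Chebyshev polynomials of the second kind with shifted index:
  \<open>cheb_poly n\<close> at \<open>2 cos \<theta>\<close> is \<open>sin (n \<theta>) / sin \<theta>\<close>.
\<close>
fun cheb_poly :: "nat \<Rightarrow> real poly" where
  "cheb_poly 0 = 0"
| "cheb_poly (Suc 0) = 1"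
| "cheb_poly (Suc (Suc n)) = [:0, 1:] * cheb_poly (Suc n) - cheb_poly n"

text \<open>The solution with initial values \<open>e\<close> and \<open>0\<close>, as a polynomial
  in the coefficient of the recurrence; \<open>m n\<close> is the forcing at index
  \<open>Suc n\<close>.\<close>

fun inhom_poly :: "(nat \<Rightarrow> real) \<Rightarrow> real \<Rightarrow> nat \<Rightarrow> real poly" where
  "inhom_poly m e 0 = [:e:]"
| "inhom_poly m e (Suc 0) = 0"
| "inhom_poly m e (Suc (Suc n)) = [:0, 1:] * inhom_poly m e (Suc n) - inhom_poly m e n + [:m n:]"

text \<open>The recurrence is imposed only at interior indices, so \<open>u 0\<close> and
  \<open>u p\<close> act as boundary values; for \<open>p = 1\<close> nothing is imposed.\<close>

definition forced :: "real \<Rightarrow> (nat \<Rightarrow> real) \<Rightarrow> nat \<Rightarrow> (nat \<Rightarrow> real) \<Rightarrow> bool" where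
  "forced t m p u \<longleftrightarrow> (\<forall>i. Suc i < p \<longrightarrow> u (Suc (Suc i)) + u i = t * u (Suc i) + m i)"

text \<open>The product with the variable has larger degree than the subtracted polynomial, so
  leading terms do not cancel. The last conjunct serves the induction, which reaches back two
  steps.\<close>

lemma degree_cheb_poly: "degree (cheb_poly (Suc n)) = n \<and> cheb_poly (Suc n) \<noteq> 0 \<and> degree (cheb_poly n) \<le> n"
proof (induction n)
  case (Suc n)
  have d: "degree ([:0, 1:] * cheb_poly (Suc n)) = Suc n"
    using Suc by (subst degree_mult_eq) auto
  have "degree (cheb_poly (Suc (Suc n))) = Suc n"
  proof (cases n)
    case 0
    then show ?thesis by simp
  next
    case (Suc k)
    with Suc.IH d have "degree (cheb_poly n) < degree ([:0, 1:] * cheb_poly (Suc n))" by simp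
    then show ?thesis using d
      by (metis degree_add_eq_left degree_minus diff_conv_add_uminus cheb_poly.simps(3))
  qed
  then show ?case using Suc by force
qed simp

text \<open>For positive \<open>n\<close> the bound is the degree of \<open>cheb_poly n\<close>, so
  the quotient by \<open>cheb_poly n\<close> stays bounded at infinity.\<close>

lemma degree_inhom_poly: "degree (inhom_poly m e n) \<le> n - 1"
proof (induction m e n rule: inhom_poly.induct)
  case (3 m e n)
  have "degree ([:0, 1:] * inhom_poly m e (Suc n)) \<le> Suc n"
    using 3 degree_mult_le[of "[:0, 1:]" "inhom_poly m e (Suc n)"] by simp
  with 3 show ?case
    by (auto intro!: degree_add_le degree_diff_le)
qed auto

text \<open>Superposition of the homogeneous solution starting with 0, 1 and the forced one starting
  with \<open>u 0\<close>, 0. At \<open>n = p\<close> it ties \<open>u 1\<close> to the boundary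
  values.\<close>

lemma forced_solution:
  assumes "forced t m p u" "n \<le> p"
  shows "u n = poly (cheb_poly n) t * u 1 + poly (inhom_poly m (u 0) n) t"
  using assms(2)
proof (induction n rule: less_induct)
  case (less n)
  consider "n = 0" | "n = 1" | k where "n = Suc (Suc k)"
    by (metis One_nat_def not0_implies_Suc)
  then show ?case
  proof cases
    case 3
    then have "u n = t * u (Suc k) + m k - u k"
      using assms(1) less.prems by (auto simp: forced_def add_eq_0_iff eq_diff_eq)
    with 3 less.IH[of k] less.IH[of "Suc k"] less.prems show ?thesis
      by (simp add: algebra_simps)
  qed auto
qed

text \<open>
  Multiplying the equation by the two Chebyshev polynomials, the right-hand side gets degree one
  more than the left-hand side can have.
\<close>
lemma finite_resonances_aux:
  fixes \<sigma> c N e e' f f' :: real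
  assumes "c \<noteq> 0" "p > 0" "q > 0"
  shows "finite {t. \<exists>u w. forced t m p u \<and> forced t m' q w \<and> u 0 = e \<and> u p = e' \<and>
           w 0 = f \<and> w q = f' \<and> u 1 + \<sigma> * w 1 = c * t + N}" (is "finite ?A")
proof -
  \<comment> \<open>At an admissible \<open>t\<close>, \<open>R\<close> and \<open>R'\<close> take
    the values of \<open>cheb_poly p\<close> times \<open>u 1\<close> and \<open>cheb_poly q\<close>
    times \<open>w 1\<close>. Nothing is divided, so roots of the Chebyshev polynomials cause no
    trouble.\<close>
  define R where "R = [:e':] - inhom_poly m e p"
  define R' where "R' = [:f':] - inhom_poly m' f q"
  define G where "G = [:N, c:] * (cheb_poly p * cheb_poly q)"
  define F where "F = R * cheb_poly q + smult \<sigma> (R' * cheb_poly p)"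
  obtain a b where ab: "p = Suc a" "q = Suc b"
    using assms by (metis gr0_implies_Suc)
  have "degree R \<le> a" "degree R' \<le> b"
    unfolding R_def R'_def using degree_inhom_poly[of m e p] degree_inhom_poly[of m' f q] ab
    by (auto intro!: degree_diff_le)
  then have "degree F \<le> a + b"
    unfolding F_def using degree_cheb_poly[of a] degree_cheb_poly[of b] ab
    by (intro degree_add_le order.trans[OF degree_smult_le] order.trans[OF degree_mult_le]) auto
  moreover have "cheb_poly p \<noteq> 0" "cheb_poly q \<noteq> 0" "degree (cheb_poly p) = a" "degree (cheb_poly q) = b"
    using degree_cheb_poly[of a] degree_cheb_poly[of b] ab by simp_all
  then have "degree G = a + b + 1"
    unfolding G_def using assms(1) by (simp add: degree_mult_eq del: mult_pCons_left)
  ultimately have "F - G \<noteq> 0" by auto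
  moreover have "?A \<subseteq> {t. poly (F - G) t = 0}"
  proof safe
    fix t u w
    assume h: "forced t m p u" "forced t m' q w" "u 1 + \<sigma> * w 1 = c * t + N"
      "e = u 0" "e' = u p" "f = w 0" "f' = w q"
    have "poly (cheb_poly p) t * u 1 = poly R t" "poly (cheb_poly q) t * w 1 = poly R' t"
      using forced_solution[OF h(1), of p] forced_solution[OF h(2), of q]
      by (simp_all add: R_def R'_def h)
    then have "poly F t = poly (cheb_poly p) t * poly (cheb_poly q) t * (u 1 + \<sigma> * w 1)"
      by (simp add: F_def algebra_simps flip: \<open>poly (cheb_poly p) t * u 1 = poly R t\<close>)
    then show "poly (F - G) t = 0"
      unfolding h(3) by (simp add: G_def algebra_simps)
  qed
  ultimately show ?thesis
    using poly_roots_finite finite_subset by blast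
qed

text \<open>\<open>E\<close> and \<open>C\<close> leave the signs of boundary values and slope open.
  Three splits along one itinerary use \<open>\<sigma> = 1\<close>, a fork uses
  \<open>\<sigma> = -1\<close>.\<close>

definition resonances ::
    "nat \<Rightarrow> (nat \<Rightarrow> real) \<Rightarrow> nat \<Rightarrow> (nat \<Rightarrow> real) \<Rightarrow> real \<Rightarrow> real set \<Rightarrow> real \<Rightarrow> real set \<Rightarrow> real set" where
  "resonances p m q m' \<sigma> C N E = {t. \<exists>u w. forced t m p u \<and> forced t m' q w \<and>
     u 0 \<in> E \<and> u p \<in> E \<and> w 0 \<in> E \<and> w q \<in> E \<and> (\<exists>c\<in>C. u 1 + \<sigma> * w 1 = c * t + N)}"

lemma resonancesI:
  assumes "forced t m p u" "forced t m' q w" "u 0 \<in> E" "u p \<in> E" "w 0 \<in> E" "w q \<in> E"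
    and "c \<in> C" "u 1 + \<sigma> * w 1 = c * t + N"
  shows "t \<in> resonances p m q m' \<sigma> C N E"
  using assms unfolding resonances_def by blast

lemma finite_resonances:
  assumes "finite C" "0 \<notin> C" "finite E" "p > 0" "q > 0"
  shows "finite (resonances p m q m' \<sigma> C N E)"
proof -
  let ?B = "\<lambda>(c, e, e', f, f'). {t. \<exists>u w. forced t m p u \<and> forced t m' q w \<and> u 0 = e \<and> u p = e' \<and>
           w 0 = f \<and> w q = f' \<and> u 1 + \<sigma> * w 1 = c * t + N}"
  have "resonances p m q m' \<sigma> C N E \<subseteq> (\<Union>z \<in> C \<times> E \<times> E \<times> E \<times> E. ?B z)"
    unfolding resonances_def by fastforce
  moreover have "finite (?B z)" if z: "z \<in> C \<times> E \<times> E \<times> E \<times> E" for z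
  proof -
    obtain c e e' f f' where z_eq: "z = (c, e, e', f, f')"
      by (metis prod_cases5)
    with z assms(2) have "c \<noteq> 0" by auto
    then show ?thesis
      unfolding z_eq prod.case by (rule finite_resonances_aux[OF _ assms(4,5)])
  qed
  then have "finite (\<Union>z \<in> C \<times> E \<times> E \<times> E \<times> E. ?B z)"
    using assms by (intro finite_UN_I finite_cartesian_product)
  ultimately show ?thesis
    by (rule finite_subset)
qed

section \<open>Affine continuation of orbits to closed cells\<close>

text \<open>Replacing \<open>frac\<close> by translation by the prescribed integer makes the orbit
  continuous in \<open>x\<close>, also on cell boundaries, where \<open>twist_map\<close> may
  jump.\<close>

primrec affine_orbit :: "real \<Rightarrow> int list \<Rightarrow> real \<times> real \<Rightarrow> nat \<Rightarrow> real \<times> real" where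
  "affine_orbit \<Delta> ns x 0 = x"
| "affine_orbit \<Delta> ns x (Suc j) =
    (let y = affine_orbit \<Delta> ns x j; \<tau> = fst y - snd y + of_int (ns ! j) in (\<tau>, snd y + \<Delta> * (\<tau> - 1/2)))"

lemma continuous_affine_orbit: "continuous_on UNIV (\<lambda>x. affine_orbit \<Delta> ns x j)"
  by (induction j) (auto simp: Let_def intro!: continuous_intros)

text \<open>In \<open>fund_domain (ns ! j)\<close> the number \<open>\<tau> - I + ns ! j\<close>
  lies in (0,1), hence is the residue. The empty list is excluded because its intersection is the
  whole plane.\<close>

lemma cell_affine_orbit:
  assumes "x \<in> (\<Inter>j<length ns. preimage_domain \<Delta> j (ns ! j))" "j \<le> length ns" "ns \<noteq> []"
  shows "(twist_map \<Delta> ^^ j) x = affine_orbit \<Delta> ns x j \<and> fst (affine_orbit \<Delta> ns x j) \<in> {0..1}"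
  using assms(2)
proof (induction j)
  case 0
  then show ?case
    using assms(1,3) by (force simp: preimage_domain_def strip_def)
next
  case (Suc j)
  obtain \<tau> I where y: "affine_orbit \<Delta> ns x j = (\<tau>, I)"
    by fastforce
  with Suc have tw: "(twist_map \<Delta> ^^ j) x = (\<tau>, I)"
    by simp
  moreover have "(twist_map \<Delta> ^^ j) x \<in> fund_domain (ns ! j)"
    using assms(1) Suc.prems by (auto simp: preimage_domain_def Suc_le_eq)
  ultimately have "(\<tau>, I) \<in> fund_domain (ns ! j)"
    by simp
  then have b: "0 < \<tau> - I + ns ! j" "\<tau> - I + ns ! j < 1"
    by (auto simp: fund_domain_def)
  then have "frac (\<tau> - I) = \<tau> - I + ns ! j"
    by (intro frac_unique_iff[THEN iffD2]) auto
  with b y tw show ?case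
    by (simp add: twist_map_def Let_def)
qed

text \<open>A closed condition on a continuous function passes to the closure. The index
  \<open>length ns\<close> is included because a split at the last entry shows in the angle one step
  later.\<close>

lemma itin_domain_affine_orbit:
  assumes "x \<in> itin_domain \<Delta> ns" "j \<le> length ns" "ns \<noteq> []"
  shows "fst (affine_orbit \<Delta> ns x j) \<in> {0..1}"
proof -
  have "closed ((\<lambda>x. fst (affine_orbit \<Delta> ns x j)) -` {0..1})"
    by (intro closed_vimage continuous_intros continuous_affine_orbit)
  moreover have "(\<Inter>j<length ns. preimage_domain \<Delta> j (ns ! j)) \<subseteq> (\<lambda>x. fst (affine_orbit \<Delta> ns x j)) -` {0..1}"
    using cell_affine_orbit[OF _ assms(2,3)] by auto
  ultimately show ?thesis
    using assms(1) closure_minimal unfolding itin_domain_def by blast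
qed

definition centred_angle :: "real \<Rightarrow> real \<times> real \<Rightarrow> int list \<Rightarrow> nat \<Rightarrow> real" where
  "centred_angle \<Delta> x ns j = fst (affine_orbit \<Delta> ns x j) - 1/2"

text \<open>Eliminates \<open>I\<close> from \<open>I j = u j - u (Suc j) + n j\<close> and
  \<open>I (Suc j) = I j + \<Delta> * u (Suc j)\<close>.\<close>

lemma centred_angle_recurrence:
  "centred_angle \<Delta> x ns (Suc (Suc j)) + centred_angle \<Delta> x ns j =
     (2 - \<Delta>) * centred_angle \<Delta> x ns (Suc j) + of_int (ns ! Suc j - ns ! j)"
  by (simp add: centred_angle_def Let_def field_simps)

lemma centred_angle_bound:
  assumes "ns \<in> itineraries \<Delta> k x" "j \<le> k" "k \<ge> 1"
  shows "\<bar>centred_angle \<Delta> x ns j\<bar> \<le> 1/2"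
proof -
  have "fst (affine_orbit \<Delta> ns x j) \<in> {0..1}"
    using assms by (intro itin_domain_affine_orbit) (auto simp: itineraries_def)
  then show ?thesis
    unfolding centred_angle_def abs_le_iff by auto
qed

lemma affine_orbit_cong:
  assumes "\<forall>i<j. a ! i = b ! i"
  shows "affine_orbit \<Delta> a x j = affine_orbit \<Delta> b x j"
  using assms by (induction j) (auto simp: Let_def)

section \<open>Splitting of itineraries\<close>

definition first_diff :: "int list \<Rightarrow> int list \<Rightarrow> nat \<Rightarrow> bool" where
  "first_diff a b j \<longleftrightarrow> j < length a \<and> (\<forall>i<j. a ! i = b ! i) \<and> a ! j \<noteq> b ! j"

lemma ex_first_diff:
  assumes "a \<noteq> b" "length a = length b"
  shows "\<exists>j. first_diff a b j"
proof -
  have "\<exists>j. j < length a \<and> a ! j \<noteq> b ! j"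
    using assms nth_equalityI by blast
  from exists_least_iff[THEN iffD1, OF this] show ?thesis
    unfolding first_diff_def by (metis less_trans)
qed

text \<open>The affine orbits coincide up to time \<open>j\<close>, so the next angles differ by the
  nonzero integer \<open>a ! j - b ! j\<close>. In an interval of length one they must be the two
  ends.\<close>

lemma first_diff_centred_angle:
  assumes "a \<in> itineraries \<Delta> k x" "b \<in> itineraries \<Delta> k x" "first_diff a b j"
  shows "\<bar>centred_angle \<Delta> x a (Suc j)\<bar> = 1/2"
    and "centred_angle \<Delta> x b (Suc j) = - centred_angle \<Delta> x a (Suc j)"
    and "centred_angle \<Delta> x a j = centred_angle \<Delta> x b j"
proof -
  have j: "j < k"
    using assms by (auto simp: first_diff_def itineraries_def)
  have eq: "affine_orbit \<Delta> a x j = affine_orbit \<Delta> b x j"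
    using assms(3) by (intro affine_orbit_cong) (auto simp: first_diff_def)
  then show "centred_angle \<Delta> x a j = centred_angle \<Delta> x b j"
    by (simp add: centred_angle_def)
  have "centred_angle \<Delta> x a (Suc j) - centred_angle \<Delta> x b (Suc j) = of_int (a ! j - b ! j)"
    by (simp add: centred_angle_def Let_def eq)
  moreover have "\<bar>real_of_int (a ! j - b ! j)\<bar> \<ge> 1"
    using assms(3) by (auto simp: first_diff_def)
  moreover have "\<bar>centred_angle \<Delta> x a (Suc j)\<bar> \<le> 1/2" "\<bar>centred_angle \<Delta> x b (Suc j)\<bar> \<le> 1/2"
    using centred_angle_bound[OF assms(1), of "Suc j"] centred_angle_bound[OF assms(2), of "Suc j"] j
    by simp_all
  ultimately show "\<bar>centred_angle \<Delta> x a (Suc j)\<bar> = 1/2"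
    "centred_angle \<Delta> x b (Suc j) = - centred_angle \<Delta> x a (Suc j)"
    by linarith+
qed

lemma first_diff_binary:
  assumes "a \<in> itineraries \<Delta> k x" "b \<in> itineraries \<Delta> k x" "c \<in> itineraries \<Delta> k x"
    and "first_diff a b j" "first_diff a c j"
  shows "\<not> first_diff b c j"
  using first_diff_centred_angle(1,2)[OF assms(1,2,4)] first_diff_centred_angle(1,2)[OF assms(1,3,5)]
    first_diff_centred_angle(1,2)[OF assms(2,3)] by force

text \<open>The three pairwise splitting times cannot all agree, so one itinerary splits from the
  other two at different times.\<close>

lemma two_splits_of_three:
  assumes "T \<subseteq> itineraries \<Delta> k x" "card T \<ge> 3"
    and agree: "\<And>a b i. a \<in> T \<Longrightarrow> b \<in> T \<Longrightarrow> i \<le> j \<Longrightarrow> a ! i = b ! i"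
  shows "\<exists>a\<in>T. \<exists>r s. j < r \<and> r < s \<and> s < k \<and>
           \<bar>centred_angle \<Delta> x a (Suc r)\<bar> = 1/2 \<and> \<bar>centred_angle \<Delta> x a (Suc s)\<bar> = 1/2"
proof -
  obtain T' where "T' \<subseteq> T" "card T' = 3"
    using assms(2) obtain_subset_with_card_n by metis
  then obtain a b c where abc: "a \<in> T" "b \<in> T" "c \<in> T" "a \<noteq> b" "a \<noteq> c" "b \<noteq> c"
    by (auto simp: card_3_iff)
  have len: "length d = k" if "d \<in> T" for d
    using that assms(1) by (auto simp: itineraries_def)
  have late: "j < r \<and> r < k" if "first_diff d e r" "d \<in> T" "e \<in> T" for d e r
    using that agree[of d e r] len by (auto simp: first_diff_def not_less[symmetric])
  have two: ?thesis if "first_diff d e r" "first_diff d f s" "r \<noteq> s" "d \<in> T" "e \<in> T" "f \<in> T"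
    for d e f r s
  proof -
    have "\<bar>centred_angle \<Delta> x d (Suc r)\<bar> = 1/2" "\<bar>centred_angle \<Delta> x d (Suc s)\<bar> = 1/2"
      using first_diff_centred_angle(1) that assms(1) by blast+
    moreover have "j < r \<and> r < k" "j < s \<and> s < k"
      using late that by blast+
    ultimately show ?thesis
      using \<open>r \<noteq> s\<close> \<open>d \<in> T\<close> by (metis linorder_neqE_nat)
  qed
  obtain r s u where "first_diff a b r" "first_diff a c s" "first_diff b c u"
    using abc len by (metis ex_first_diff)
  \<comment> \<open>If \<open>r = s\<close>, then \<open>b\<close> takes the role of
    \<open>a\<close>, since it splits from \<open>a\<close> and \<open>c\<close> at the different
    times \<open>r\<close> and \<open>u\<close>.\<close>
  moreover from this have "first_diff b a r"
    using abc len by (auto simp: first_diff_def)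
  moreover have "\<not> (r = s \<and> r = u)"
    using first_diff_binary abc assms(1) calculation by blast
  ultimately show ?thesis
    using two abc by metis
qed

section \<open>Resonant parameters\<close>

text \<open>Only the angle conditions are kept, so the set depends on the code and the times alone.
  The times are those of extreme angles, one later than the splits.\<close>

definition triple_resonance :: "nat \<Rightarrow> nat \<Rightarrow> nat \<Rightarrow> int list \<Rightarrow> real set" where
  "triple_resonance r s u a = {\<Delta>. \<exists>x. \<bar>centred_angle \<Delta> x a r\<bar> = 1/2 \<and>
     \<bar>centred_angle \<Delta> x a s\<bar> = 1/2 \<and> \<bar>centred_angle \<Delta> x a u\<bar> = 1/2}"

text \<open>Here \<open>j\<close> is the common split itself, while \<open>p\<close> and
  \<open>q\<close> are one later than the further splits of \<open>a\<close> and
  \<open>b\<close>.\<close>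

definition forked_resonance :: "nat \<Rightarrow> nat \<Rightarrow> nat \<Rightarrow> int list \<Rightarrow> int list \<Rightarrow> real set" where
  "forked_resonance j p q a b = {\<Delta>. \<exists>x. centred_angle \<Delta> x a j = centred_angle \<Delta> x b j \<and>
     \<bar>centred_angle \<Delta> x a (Suc j)\<bar> = 1/2 \<and> centred_angle \<Delta> x b (Suc j) = - centred_angle \<Delta> x a (Suc j) \<and>
     \<bar>centred_angle \<Delta> x a p\<bar> = 1/2 \<and> \<bar>centred_angle \<Delta> x b q\<bar> = 1/2}"

lemma forced_forward:
  "forced (2 - \<Delta>) (\<lambda>i. of_int (a ! (Suc i + j) - a ! (i + j))) p (\<lambda>i. centred_angle \<Delta> x a (i + j))"
  using centred_angle_recurrence[of \<Delta> x a] by (simp add: forced_def)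

text \<open>The recurrence is symmetric under time reversal. The bound on \<open>p\<close> keeps the
  subtractions from truncating.\<close>

lemma forced_backward:
  assumes "p \<le> j"
  shows "forced (2 - \<Delta>) (\<lambda>i. of_int (a ! (j - Suc i) - a ! (j - Suc (Suc i)))) p
           (\<lambda>i. centred_angle \<Delta> x a (j - i))"
  unfolding forced_def
proof safe
  fix i assume "Suc i < p"
  then obtain l where "j = l + Suc (Suc i)"
    using assms by (metis Suc_leI le_trans le_iff_add add.commute)
  then show "centred_angle \<Delta> x a (j - Suc (Suc i)) + centred_angle \<Delta> x a (j - i) =
      (2 - \<Delta>) * centred_angle \<Delta> x a (j - Suc i) + real_of_int (a ! (j - Suc i) - a ! (j - Suc (Suc i)))"
    using centred_angle_recurrence[of \<Delta> x a l] by (simp add: Suc_diff_le)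
qed

lemma abs_eq_half: "\<bar>y\<bar> = 1/2 \<longleftrightarrow> y \<in> {1/2, -1/2}" for y :: real
  by auto

text \<open>The boundary value problems from \<open>s\<close> back to \<open>r\<close> and on to
  \<open>u\<close> govern the two neighbours of the angle at \<open>s\<close>. The recurrence at
  \<open>s\<close> relates their sum to \<open>2 - \<Delta>\<close> with slope
  \<open>\<plusminus>1/2\<close>.\<close>

lemma finite_triple_resonance:
  assumes "r < s" "s < u"
  shows "finite (triple_resonance r s u a)"
proof -
  let ?E = "{1/2, -1/2 :: real}"
  obtain s' where s': "s = Suc s'"
    using assms by (metis not0_implies_Suc not_less0)
  let ?A = "resonances (s - r) (\<lambda>i. of_int (a ! (s - Suc i) - a ! (s - Suc (Suc i))))
     (u - s) (\<lambda>i. of_int (a ! (Suc i + s) - a ! (i + s))) 1 ?E (of_int (a ! s - a ! s')) ?E"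
  have "finite ?A"
    using assms by (intro finite_resonances) auto
  then have "finite ((\<lambda>\<Delta>. 2 - \<Delta>) -` ?A)"
    by (rule finite_vimageI) (auto simp: inj_def)
  moreover have "triple_resonance r s u a \<subseteq> (\<lambda>\<Delta>. 2 - \<Delta>) -` ?A"
  proof
    fix \<Delta> assume "\<Delta> \<in> triple_resonance r s u a"
    then obtain x where x: "centred_angle \<Delta> x a r \<in> ?E" "centred_angle \<Delta> x a s \<in> ?E"
      "centred_angle \<Delta> x a u \<in> ?E"
      unfolding triple_resonance_def abs_eq_half by blast
    have "centred_angle \<Delta> x a s' + centred_angle \<Delta> x a (Suc s) =
        centred_angle \<Delta> x a s * (2 - \<Delta>) + of_int (a ! s - a ! s')"
      using centred_angle_recurrence[of \<Delta> x a s'] by (simp add: s' algebra_simps)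
    then have "2 - \<Delta> \<in> ?A"
      using x s' assms
      by (intro resonancesI[OF forced_backward forced_forward, where c = "centred_angle \<Delta> x a s"])
        simp_all
    then show "\<Delta> \<in> (\<lambda>\<Delta>. 2 - \<Delta>) -` ?A"
      by simp
  qed
  ultimately show ?thesis
    using finite_subset by blast
qed

text \<open>Subtracting the recurrences of \<open>a\<close> and \<open>b\<close> at
  \<open>Suc j\<close> cancels the common angle at \<open>j\<close>. As the angles at
  \<open>Suc j\<close> are opposite, the slope is \<open>\<plusminus>1\<close>.\<close>

lemma finite_forked_resonance:
  assumes "Suc j < p" "Suc j < q"
  shows "finite (forked_resonance j p q a b)"
proof -
  let ?E = "{1/2, -1/2 :: real}"
  let ?A = "resonances (p - Suc j) (\<lambda>i. of_int (a ! (Suc i + Suc j) - a ! (i + Suc j)))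
     (q - Suc j) (\<lambda>i. of_int (b ! (Suc i + Suc j) - b ! (i + Suc j))) (-1) {1, -1}
     (of_int (a ! Suc j - a ! j) - of_int (b ! Suc j - b ! j)) ?E"
  have "finite ?A"
    using assms by (intro finite_resonances) auto
  then have "finite ((\<lambda>\<Delta>. 2 - \<Delta>) -` ?A)"
    by (rule finite_vimageI) (auto simp: inj_def)
  moreover have "forked_resonance j p q a b \<subseteq> (\<lambda>\<Delta>. 2 - \<Delta>) -` ?A"
  proof
    fix \<Delta> assume "\<Delta> \<in> forked_resonance j p q a b"
    then obtain x where x: "centred_angle \<Delta> x a j = centred_angle \<Delta> x b j"
      "centred_angle \<Delta> x b (Suc j) = - centred_angle \<Delta> x a (Suc j)"
      "centred_angle \<Delta> x a (Suc j) \<in> ?E" "centred_angle \<Delta> x a p \<in> ?E" "centred_angle \<Delta> x b q \<in> ?E"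
      unfolding forked_resonance_def abs_eq_half by blast
    have "centred_angle \<Delta> x a (Suc (Suc j)) + (-1) * centred_angle \<Delta> x b (Suc (Suc j)) =
        (2 * centred_angle \<Delta> x a (Suc j)) * (2 - \<Delta>) + (of_int (a ! Suc j - a ! j) - of_int (b ! Suc j - b ! j))"
      using centred_angle_recurrence[of \<Delta> x a j] centred_angle_recurrence[of \<Delta> x b j] x(1)
      by (simp add: x(2) algebra_simps)
    moreover have "2 * centred_angle \<Delta> x a (Suc j) \<in> {1, -1}" "centred_angle \<Delta> x b (Suc j) \<in> ?E"
      using x by auto
    ultimately have "2 - \<Delta> \<in> ?A"
      using assms x(3-5)
      by (intro resonancesI[OF forced_forward forced_forward, where c = "2 * centred_angle \<Delta> x a (Suc j)"])
        simp_all
    then show "\<Delta> \<in> (\<lambda>\<Delta>. 2 - \<Delta>) -` ?A"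
      by simp
  qed
  ultimately show ?thesis
    using finite_subset by blast
qed

section \<open>Four itineraries force a resonance\<close>

text \<open>The earliest split \<open>j\<close> divides \<open>S\<close> into two branches. Three
  members in one branch give two later splits besides \<open>j\<close>; otherwise both branches have
  two members and split again.\<close>

lemma resonance_of_four:
  assumes S: "S \<subseteq> itineraries \<Delta> k x" "finite S" "card S > 3"
  shows "(\<exists>a\<in>S. \<exists>r s u. r < s \<and> s < u \<and> u \<le> k \<and> \<Delta> \<in> triple_resonance r s u a) \<or>
    (\<exists>a\<in>S. \<exists>b\<in>S. \<exists>j p q. Suc j < p \<and> p \<le> k \<and> Suc j < q \<and> q \<le> k \<and> \<Delta> \<in> forked_resonance j p q a b)"
proof (rule ccontr)
  assume nores: "\<not> ?thesis"
  have no_triple: False if "a \<in> S" "r < s" "s < u" "u \<le> k" "\<Delta> \<in> triple_resonance r s u a" for a r s u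
    using nores[THEN notE, OF disjI1] that by blast
  have no_fork: False if "a \<in> S" "b \<in> S" "Suc i < p" "p \<le> k" "Suc i < q" "q \<le> k"
    "\<Delta> \<in> forked_resonance i p q a b" for a b i p q
    using nores[THEN notE, OF disjI2] that by blast
  have len: "length d = k" if "d \<in> S" for d
    using that S(1) by (auto simp: itineraries_def)
  define splits where "splits = (\<lambda>i. \<exists>a\<in>S. \<exists>b\<in>S. first_diff a b i)"
  define j where "j = (LEAST i. splits i)"
  have "\<not> card S \<le> Suc 0" using S by simp
  then obtain a b where "a \<in> S" "b \<in> S" "a \<noteq> b"
    using S(2) by (auto simp: card_le_Suc0_iff_eq)
  then have "\<exists>i. splits i"
    unfolding splits_def using ex_first_diff[of a b] len by blast
  then have "splits j"
    unfolding j_def by (rule LeastI_ex)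
  then obtain a0 b0 where ab: "a0 \<in> S" "b0 \<in> S" "first_diff a0 b0 j"
    unfolding splits_def by blast
  have least: "\<not> first_diff a b i" if "i < j" "a \<in> S" "b \<in> S" for i a b
    using not_less_Least[of i splits] that unfolding j_def splits_def by blast
  have agree: "a ! i = b ! i" if "a \<in> S" "b \<in> S" "i < j" for a b i
  proof (rule ccontr)
    assume ne: "a ! i \<noteq> b ! i"
    then obtain l where l: "first_diff a b l"
      using ex_first_diff len \<open>a \<in> S\<close> \<open>b \<in> S\<close> by metis
    with ne have "l \<le> i"
      by (meson first_diff_def not_le)
    with l least that show False by (meson le_less_trans)
  qed
  have jk: "j < k" and ne: "a0 ! j \<noteq> b0 ! j"
    using ab len by (auto simp: first_diff_def)
  have fd: "first_diff a b j" if "a \<in> S" "b \<in> S" "a ! j \<noteq> b ! j" for a b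
    unfolding first_diff_def using that agree[of a b] len[of a] jk by simp
  define T where "T = (\<lambda>v. {s\<in>S. s ! j = v})"
  have late: "\<exists>p. j < p \<and> p < k \<and> first_diff a b p" if "a \<in> T v" "b \<in> T v" "a \<noteq> b" for a b v
  proof -
    have mem: "a \<in> S" "b \<in> S" "a ! j = b ! j"
      using that by (auto simp: T_def)
    obtain p where p: "first_diff a b p"
      using ex_first_diff[OF \<open>a \<noteq> b\<close>] mem len by auto
    have "\<not> p < j" "p \<noteq> j"
      using p mem agree[of a b p] by (auto simp: first_diff_def)
    then show ?thesis
      using p mem len[of a] by (auto simp: first_diff_def intro: exI[of _ p])
  qed
  have cardT: "card (T v) \<le> 2" for v
  proof (rule ccontr)
    assume "\<not> ?thesis"
    then have "card (T v) \<ge> 3" by simp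
    moreover have "T v \<subseteq> itineraries \<Delta> k x"
      using S(1) by (auto simp: T_def)
    moreover have "a ! i = b ! i" if "a \<in> T v" "b \<in> T v" "i \<le> j" for a b i
      using that agree[of a b i] by (cases "i = j") (simp_all add: T_def)
    ultimately have "\<exists>a\<in>T v. \<exists>r s. j < r \<and> r < s \<and> s < k \<and>
        \<bar>centred_angle \<Delta> x a (Suc r)\<bar> = 1/2 \<and> \<bar>centred_angle \<Delta> x a (Suc s)\<bar> = 1/2"
      using two_splits_of_three by blast
    then obtain a r s where a: "a \<in> T v" "j < r" "r < s" "s < k"
      "\<bar>centred_angle \<Delta> x a (Suc r)\<bar> = 1/2" "\<bar>centred_angle \<Delta> x a (Suc s)\<bar> = 1/2"
      by blast
    then have aS: "a \<in> S" by (simp add: T_def)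
    \<comment> \<open>\<open>a\<close> differs at \<open>j\<close> from at least one of
      \<open>a0\<close> and \<open>b0\<close>, so it takes part in the first split too.\<close>
    obtain b where "b \<in> S" "first_diff a b j"
      using fd[OF aS ab(1)] fd[OF aS ab(2)] ab(1,2) ne by fastforce
    then have "\<bar>centred_angle \<Delta> x a (Suc j)\<bar> = 1/2"
      using first_diff_centred_angle(1) S(1) aS by blast
    with a have "\<Delta> \<in> triple_resonance (Suc j) (Suc r) (Suc s) a"
      unfolding triple_resonance_def by blast
    with a aS show False
      by (intro no_triple) simp_all
  qed
  \<comment> \<open>A third value at \<open>j\<close> would contradict
    \<open>first_diff_binary\<close>.\<close>
  have "s ! j = a0 ! j \<or> s ! j = b0 ! j" if "s \<in> S" for s
    using first_diff_binary[of a0 \<Delta> k x b0 s j] S(1) ab fd[of a0 s] fd[of b0 s] that by fastforce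
  then have "S = T (a0 ! j) \<union> T (b0 ! j)"
    unfolding T_def by blast
  then have "card S \<le> card (T (a0 ! j)) + card (T (b0 ! j))"
    using card_Un_le[of "T (a0 ! j)" "T (b0 ! j)"] by simp
  with S(3) cardT[of "a0 ! j"] cardT[of "b0 ! j"]
  have "card (T (a0 ! j)) = 2" "card (T (b0 ! j)) = 2"
    by linarith+
  then obtain a a' b b' where ab': "a \<in> T (a0 ! j)" "a' \<in> T (a0 ! j)" "a \<noteq> a'"
    "b \<in> T (b0 ! j)" "b' \<in> T (b0 ! j)" "b \<noteq> b'"
    unfolding card_2_iff by blast
  obtain p q where pq: "j < p" "p < k" "first_diff a a' p" "j < q" "q < k" "first_diff b b' q"
    using late[OF ab'(1-3)] late[OF ab'(4-6)] by blast
  have inS: "a \<in> S" "b \<in> S" and it: "a \<in> itineraries \<Delta> k x" "b \<in> itineraries \<Delta> k x"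
    "a' \<in> itineraries \<Delta> k x" "b' \<in> itineraries \<Delta> k x"
    using ab' S(1) by (auto simp: T_def)
  have "first_diff a b j"
    using ab' ne by (intro fd) (auto simp: T_def)
  then have "\<Delta> \<in> forked_resonance j (Suc p) (Suc q) a b"
    using first_diff_centred_angle[of a \<Delta> k x b j] first_diff_centred_angle(1)[of a \<Delta> k x a' p]
      first_diff_centred_angle(1)[of b \<Delta> k x b' q] it pq
    unfolding forked_resonance_def by blast
  with inS pq show False
    by (intro no_fork) simp_all
qed

section \<open>Finitely many codes, and discreteness\<close>

definition bounded_codes :: "nat \<Rightarrow> int \<Rightarrow> int list set" where
  "bounded_codes k M = {ns. set ns \<subseteq> {- M..M} \<and> length ns = k}"

lemma finite_bounded_codes: "finite (bounded_codes k M)"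
  unfolding bounded_codes_def by (rule finite_lists_length_eq) simp

text \<open>The recurrence bounds each jump of the code by
  \<open>1/2 + 1/2 + (2 + 2 * M)/2 = M + 2\<close>, and the code starts at 0. The bound is uniform
  in \<open>x\<close> and in the bounded range of \<open>\<Delta>\<close>.\<close>

lemma itineraries_bounded:
  assumes "k \<ge> 1" "\<bar>\<Delta>\<bar> \<le> 2 * real M"
  shows "{ns \<in> itineraries \<Delta> k x. ns ! 0 = 0} \<subseteq> bounded_codes k (int (k * (M + 2)))"
proof safe
  fix ns assume ns: "ns \<in> itineraries \<Delta> k x" "ns ! 0 = 0"
  have len: "length ns = k"
    using ns by (simp add: itineraries_def)
  have "\<bar>ns ! j\<bar> \<le> int (j * (M + 2))" if "j < k" for j
    using that
  proof (induction j)
    case (Suc j)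
    let ?u = "centred_angle \<Delta> x ns"
    have b: "\<bar>?u j\<bar> \<le> 1/2" "\<bar>?u (Suc j)\<bar> \<le> 1/2" "\<bar>?u (Suc (Suc j))\<bar> \<le> 1/2"
      using Suc.prems by (intro centred_angle_bound[OF ns(1) _ assms(1)]; simp)+
    have "\<bar>(2 - \<Delta>) * ?u (Suc j)\<bar> \<le> (2 + 2 * real M) * (1/2)"
      unfolding abs_mult using b assms(2) by (intro mult_mono) auto
    with b have "\<bar>real_of_int (ns ! Suc j - ns ! j)\<bar> \<le> real (M + 2)"
      using centred_angle_recurrence[of \<Delta> x ns j] by auto
    then have "\<bar>ns ! Suc j - ns ! j\<bar> \<le> int (M + 2)"
      by linarith
    with Suc show ?case by (auto simp: algebra_simps)
  qed (use ns in simp)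
  moreover have "int (j * (M + 2)) \<le> int (k * (M + 2))" if "j < k" for j
    using that by (intro of_nat_mono mult_right_mono) auto
  ultimately have "\<bar>ns ! j\<bar> \<le> int (k * (M + 2))" if "j < k" for j
    using that order.trans by blast
  then show "ns \<in> bounded_codes k (int (k * (M + 2)))"
    using len by (force simp: bounded_codes_def in_set_conv_nth)
qed

lemma LC_attained:
  assumes "k \<ge> 1"
  shows "\<exists>x. LC k \<Delta> = LC_at k \<Delta> x"
proof -
  obtain M :: nat where M: "\<bar>\<Delta>\<bar> \<le> 2 * real M"
    using real_arch_simple[of "\<bar>\<Delta>\<bar> / 2"] by (auto simp: mult.commute)
  let ?A = "LC_at k \<Delta> ` closure (fund_domain 0)"
  have "?A \<subseteq> {..card (bounded_codes k (int (k * (M + 2))))}"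
    using itineraries_bounded[OF assms M] finite_bounded_codes
    by (auto simp: LC_at_def intro!: card_mono)
  then have "finite ?A"
    by (rule finite_subset) simp
  moreover have "(1/2, 0) \<in> fund_domain 0"
    by (simp add: fund_domain_def strip_def)
  then have "?A \<noteq> {}"
    using closure_subset by blast
  ultimately have "LC k \<Delta> \<in> ?A"
    unfolding LC_def by (rule Max_in)
  then show ?thesis by blast
qed

text \<open>One finite set of codes serves the whole range of \<open>\<Delta>\<close>, so the
  resonances met there form a finite union of finite sets.\<close>

lemma finite_LC_gt_3:
  assumes "k \<ge> 1"
  shows "finite {\<Delta>. \<bar>\<Delta>\<bar> \<le> 2 * real M \<and> LC k \<Delta> > 3}"
proof -
  define L where "L = bounded_codes k (int (k * (M + 2)))"
  define X where "X = (\<Union>a\<in>L. \<Union>r\<in>{..k}. \<Union>s\<in>{..k} \<inter> {r<..}. \<Union>u\<in>{..k} \<inter> {s<..}. triple_resonance r s u a)"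
  define Y where "Y = (\<Union>a\<in>L. \<Union>b\<in>L. \<Union>j\<in>{..k}. \<Union>p\<in>{..k} \<inter> {Suc j<..}. \<Union>q\<in>{..k} \<inter> {Suc j<..}.
    forked_resonance j p q a b)"
  have fin: "finite L"
    unfolding L_def by (rule finite_bounded_codes)
  have "finite X"
    unfolding X_def by (intro finite_UN_I fin) (auto intro!: finite_triple_resonance)
  moreover have "finite Y"
    unfolding Y_def by (intro finite_UN_I fin) (auto intro!: finite_forked_resonance)
  moreover have "{\<Delta>. \<bar>\<Delta>\<bar> \<le> 2 * real M \<and> LC k \<Delta> > 3} \<subseteq> X \<union> Y"
  proof safe
    fix \<Delta> assume h: "\<bar>\<Delta>\<bar> \<le> 2 * real M" "LC k \<Delta> > 3" "\<Delta> \<notin> Y"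
    obtain x where x: "LC k \<Delta> = LC_at k \<Delta> x"
      using LC_attained assms by blast
    let ?S = "{ns \<in> itineraries \<Delta> k x. ns ! 0 = 0}"
    have S: "?S \<subseteq> L"
      unfolding L_def using itineraries_bounded assms h by blast
    have "card ?S > 3"
      using h x by (simp add: LC_at_def)
    moreover have "finite ?S"
      using S fin finite_subset by blast
    ultimately have "(\<exists>a\<in>?S. \<exists>r s u. r < s \<and> s < u \<and> u \<le> k \<and> \<Delta> \<in> triple_resonance r s u a) \<or>
      (\<exists>a\<in>?S. \<exists>b\<in>?S. \<exists>j p q. Suc j < p \<and> p \<le> k \<and> Suc j < q \<and> q \<le> k \<and> \<Delta> \<in> forked_resonance j p q a b)"
      by (intro resonance_of_four) auto
    then show "\<Delta> \<in> X"
    proof (elim disjE bexE exE conjE)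
      fix a r s u
      assume "a \<in> ?S" "r < s" "s < u" "u \<le> k" "\<Delta> \<in> triple_resonance r s u a"
      then show ?thesis
        unfolding X_def using S by (intro UN_I[of a] UN_I[of r] UN_I[of s] UN_I[of u]) auto
    next
      fix a b j p q
      assume "a \<in> ?S" "b \<in> ?S" "Suc j < p" "p \<le> k" "Suc j < q" "q \<le> k"
        "\<Delta> \<in> forked_resonance j p q a b"
      then have "\<Delta> \<in> Y"
        unfolding Y_def using S
        by (intro UN_I[of a] UN_I[of b] UN_I[of j] UN_I[of p] UN_I[of q]) auto
      with h show ?thesis by simp
    qed
  qed
  ultimately show ?thesis
    using finite_subset by blast
qed

theorem lemmaA1:
  fixes k :: nat
  assumes "k \<ge> 1"
  shows "discrete {\<Delta> :: real. \<Delta> < 0 \<and> LC k \<Delta> > 3}"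
proof (rule discreteI)
  let ?S = "{\<Delta> :: real. \<Delta> < 0 \<and> LC k \<Delta> > 3}"
  fix z assume z: "z \<in> ?S"
  obtain M :: nat where M: "\<bar>z\<bar> + 1 \<le> 2 * real M"
    using real_arch_simple[of "(\<bar>z\<bar> + 1) / 2"] by (auto simp: mult.commute)
  let ?F = "{\<Delta>. \<bar>\<Delta>\<bar> \<le> 2 * real M \<and> LC k \<Delta> > 3}"
  \<comment> \<open>By the choice of \<open>M\<close> the unit ball lies in the range of
    \<open>?F\<close>; removing the finitely many other exceptional parameters isolates
    \<open>z\<close>.\<close>
  have "open (ball z 1 - (?F - {z}))"
    using finite_LC_gt_3[OF assms] by (intro open_Diff open_ball finite_imp_closed) auto
  moreover have "(ball z 1 - (?F - {z})) \<inter> ?S = {z}"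
    using z M by (auto simp: dist_real_def)
  ultimately show "z isolated_in ?S"
    using z unfolding isolated_in_def by blast
qed

end
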